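(* Let $b$ be an integer with $|b|\ge 2$ and let $w$ be an integer with $w\ge 2$. Let $\mathcal{D}$ be the digit set consisting of $0$ and all integers that have absolute value strictly smaller than $\frac12|b|^w$ and are not divisible by $b$. Then, for each integer, its $w$-NAF-expansion to the base $b$ with digit set $\mathcal{D}$ is optimal.
   Context: A multi-expansion of $z\in\mathbb{Z}$ (base $b$, digit set $\mathcal{D}$) is a finite multiset of pairs $(d,n)\in(\mathcal{D}\setminus\{0\})\times\mathbb{N}_0$ with $\sum d\,b^n=z$ (sum with multiplicity); its weight is its cardinality counted with multiplicity. An expansion is a multi-expansion in which the exponents $n$ are pairwise distinct, identified with a finitely supported sequence $(\eta_n)_{n\in\mathbb{N}_0}\in\mathcal{D}^{\mathbb{N}_0}$ with $\sum_n\eta_n b^n=z$. A $w$-NAF-expansion is an expansion such that every block of $w$ consecutive digits $\eta_{j+w-1}\ldots\eta_j$ contains at most one non-zero digit. In this setting each integer has exactly one $w$-NAF-expansion (a known fact). An expansion of $z$ is optimal if its weight is at most the weight of every multi-expansion of $z$. *)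

theory Defs
  imports Main "HOL-Library.Multiset"
begin

definition multi_expansion :: "int \<Rightarrow> int set \<Rightarrow> int \<Rightarrow> (int \<times> nat) multiset \<Rightarrow> bool" where
  "multi_expansion b D z M \<longleftrightarrow>
     set_mset M \<subseteq> (D - {0}) \<times> UNIV \<and> (\<Sum>(d, n)\<in>#M. d * b ^ n) = z"

definition digits_value :: "int \<Rightarrow> (nat \<Rightarrow> int) \<Rightarrow> int" where
  "digits_value b \<eta> = (\<Sum>n | \<eta> n \<noteq> 0. \<eta> n * b ^ n)"

definition expansion :: "int \<Rightarrow> int set \<Rightarrow> int \<Rightarrow> (nat \<Rightarrow> int) \<Rightarrow> bool" where
  "expansion b D z \<eta> \<longleftrightarrow>
     (\<forall>n. \<eta> n \<in> D) \<and> finite {n. \<eta> n \<noteq> 0} \<and> digits_value b \<eta> = z"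

text \<open>
  The identification of a finitely supported digit sequence with a multiset of pairs
  (digit, exponent) whose exponents are pairwise distinct.
\<close>

definition digits_mset :: "(nat \<Rightarrow> int) \<Rightarrow> (int \<times> nat) multiset" where
  "digits_mset \<eta> = image_mset (\<lambda>n. (\<eta> n, n)) (mset_set {n. \<eta> n \<noteq> 0})"

definition naf_expansion :: "int \<Rightarrow> int set \<Rightarrow> nat \<Rightarrow> int \<Rightarrow> (nat \<Rightarrow> int) \<Rightarrow> bool" where
  "naf_expansion b D w z \<eta> \<longleftrightarrow>
     expansion b D z \<eta> \<and> (\<forall>j. card {n \<in> {j..<j + w}. \<eta> n \<noteq> 0} \<le> 1)"

definition optimal_expansion :: "int \<Rightarrow> int set \<Rightarrow> int \<Rightarrow> (nat \<Rightarrow> int) \<Rightarrow> bool" where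
  "optimal_expansion b D z \<eta> \<longleftrightarrow>
     expansion b D z \<eta> \<and>
     (\<forall>M. multi_expansion b D z M \<longrightarrow> size (digits_mset \<eta>) \<le> size M)"

text \<open>The bound \<open>\<bar>d\<bar> < \<bar>b\<bar> ^ w / 2\<close> is written without division.\<close>

definition naf_digits :: "int \<Rightarrow> nat \<Rightarrow> int set" where
  "naf_digits b w = {0} \<union> {d. 2 * \<bar>d\<bar> < \<bar>b\<bar> ^ w \<and> \<not> b dvd d}"

lemma expansion_imp_multi_expansion:
  assumes "expansion b D z \<eta>"
  shows "multi_expansion b D z (digits_mset \<eta>)"
proof -
  have "digits_value b \<eta> = (\<Sum>(d, n)\<in>#digits_mset \<eta>. d * b ^ n)"
    by (simp add: digits_value_def digits_mset_def sum_unfold_sum_mset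
        image_mset.compositionality o_def)
  moreover have "set_mset (digits_mset \<eta>) \<subseteq> (D - {0}) \<times> UNIV"
    using assms by (auto simp: expansion_def digits_mset_def)
  ultimately show ?thesis
    using assms by (simp add: expansion_def multi_expansion_def)
qed

lemma multi_expansion_imp_expansion:
  assumes M: "multi_expansion b D z M" and D: "0 \<in> D"
    and inj: "\<And>n. size (filter_mset (\<lambda>p. snd p = n) M) \<le> 1"
  shows "\<exists>\<eta>. expansion b D z \<eta> \<and> digits_mset \<eta> = M"
proof -
  have uniq: "d = e" if "(d, n) \<in># M" "(e, n) \<in># M" for d e n
  proof (rule ccontr)
    assume "d \<noteq> e"
    then have "{#(d, n), (e, n)#} \<subseteq># filter_mset (\<lambda>p. snd p = n) M"
      using that by (simp add: insert_subset_eq_iff in_diff_count)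
    from size_mset_mono[OF this] inj[of n] show False by simp
  qed
  have cnt: "count M p \<le> 1" for p
  proof -
    have "count M p \<le> size (filter_mset (\<lambda>q. snd q = snd p) M)"
      using count_le_size[of "filter_mset (\<lambda>q. snd q = snd p) M" p] by simp
    then show ?thesis using inj[of "snd p"] by linarith
  qed
  have nz: "d \<noteq> 0 \<and> d \<in> D" if "(d, n) \<in># M" for d n
    using M that by (auto simp: multi_expansion_def)
  define \<eta> where "\<eta> n = (if \<exists>d. (d, n) \<in># M then THE d. (d, n) \<in># M else 0)" for n
  have eta: "\<eta> n = d" if "(d, n) \<in># M" for d n
  proof -
    have "(THE d. (d, n) \<in># M) = d"
      by (rule the_equality) (use that uniq[OF _ that] in blast)+
    then show ?thesis unfolding \<eta>_def using that by auto
  qed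
  have eta0: "\<eta> n = 0" if "\<nexists>d. (d, n) \<in># M" for n
    using that by (simp add: \<eta>_def)
  have supp: "{n. \<eta> n \<noteq> 0} = snd ` set_mset M"
  proof (intro set_eqI iffI)
    fix n assume "n \<in> {n. \<eta> n \<noteq> 0}"
    then obtain d where "(d, n) \<in># M" using eta0 by blast
    then show "n \<in> snd ` set_mset M" by force
  next
    fix n assume "n \<in> snd ` set_mset M"
    then obtain d where "(d, n) \<in># M" by auto
    then show "n \<in> {n. \<eta> n \<noteq> 0}" using eta nz by auto
  qed
  have img: "(\<lambda>n. (\<eta> n, n)) ` {n. \<eta> n \<noteq> 0} = set_mset M"
  proof -
    have "(\<eta> (snd p), snd p) = p" if "p \<in># M" for p
      using eta[of "fst p" "snd p"] that by simp
    then show ?thesis unfolding supp image_image by simp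
  qed
  have "digits_mset \<eta> = mset_set (set_mset M)"
    unfolding digits_mset_def img[symmetric]
    by (subst image_mset_mset_set) (auto simp: inj_on_def)
  also have "\<dots> = M"
  proof (rule multiset_eqI)
    fix p
    show "count (mset_set (set_mset M)) p = count M p"
    proof (cases "p \<in># M")
      case True
      then have "count M p \<ge> 1" by simp
      then have "count M p = 1" using cnt[of p] by linarith
      then show ?thesis using True by simp
    next
      case False
      then show ?thesis by (simp add: not_in_iff)
    qed
  qed
  finally have eq: "digits_mset \<eta> = M" .
  have "\<eta> n \<in> D" for n
    using eta[of _ n] eta0[of n] nz[of _ n] D by metis
  moreover have "finite {n. \<eta> n \<noteq> 0}" by (simp add: supp)
  moreover have "digits_value b \<eta> = (\<Sum>(d, n)\<in>#digits_mset \<eta>. d * b ^ n)"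
    by (simp add: digits_value_def digits_mset_def sum_unfold_sum_mset
        image_mset.compositionality o_def)
  ultimately show ?thesis
    using M eq unfolding expansion_def multi_expansion_def by metis
qed

lemma digits_value_split:
  assumes "finite {n. \<eta> n \<noteq> 0}"
  shows "digits_value b \<eta> = (\<Sum>n<k. \<eta> n * b ^ n) + b ^ k * digits_value b (\<lambda>n. \<eta> (n + k))"
proof -
  have val: "digits_value b \<theta> = (\<Sum>n<N. \<theta> n * b ^ n)" if "{n. \<theta> n \<noteq> 0} \<subseteq> {..<N}" for \<theta> N
    unfolding digits_value_def using that by (intro sum.mono_neutral_left) auto
  obtain N where "\<forall>n\<in>{n. \<eta> n \<noteq> 0}. n < N"
    using assms finite_nat_set_iff_bounded by blast
  then have N: "{n. \<eta> n \<noteq> 0} \<subseteq> {..<k + N}" "{n. \<eta> (n + k) \<noteq> 0} \<subseteq> {..<N}"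
    by force+
  have "(\<Sum>n<k + N. \<eta> n * b ^ n) = (\<Sum>n<k. \<eta> n * b ^ n) + (\<Sum>n<N. \<eta> (n + k) * b ^ (n + k))"
    by (induction N) (auto simp: add.commute)
  then show ?thesis
    unfolding val[OF N(1)] val[OF N(2)] by (simp add: sum_distrib_left power_add mult_ac)
qed

lemma naf_expansion_shift:
  assumes "naf_expansion b D w z \<eta>"
  shows "naf_expansion b D w (digits_value b (\<lambda>n. \<eta> (n + k))) (\<lambda>n. \<eta> (n + k))"
proof -
  have fin: "finite {n. \<eta> n \<noteq> 0}" and D: "\<And>n. \<eta> n \<in> D"
    using assms by (auto simp: naf_expansion_def expansion_def)
  have "finite {n. \<eta> (n + k) \<noteq> 0}"
    using finite_vimageI[OF fin, of "\<lambda>n. n + k"] by (simp add: vimage_def)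
  moreover have "card {n \<in> {j..<j + w}. \<eta> (n + k) \<noteq> 0} \<le> 1" for j
  proof -
    have "card {n \<in> {j..<j + w}. \<eta> (n + k) \<noteq> 0} =
        card ((\<lambda>n. n + k) ` {n \<in> {j..<j + w}. \<eta> (n + k) \<noteq> 0})"
      by (simp add: card_image)
    also have "\<dots> \<le> card {n \<in> {j + k..<(j + k) + w}. \<eta> n \<noteq> 0}"
      by (rule card_mono) auto
    also have "\<dots> \<le> 1" using assms by (simp add: naf_expansion_def)
    finally show ?thesis .
  qed
  ultimately show ?thesis using D by (simp add: naf_expansion_def expansion_def)
qed

lemma naf_digit_0:
  assumes "naf_expansion b (naf_digits b w) w z \<eta>" and "w \<ge> 2"
  shows "b dvd z - \<eta> 0" and "\<eta> 0 \<noteq> 0 \<Longrightarrow> b ^ w dvd z - \<eta> 0"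
proof -
  have fin: "finite {n. \<eta> n \<noteq> 0}" and z: "digits_value b \<eta> = z"
    using assms by (auto simp: naf_expansion_def expansion_def)
  show "b dvd z - \<eta> 0"
    using digits_value_split[OF fin, of b 1] z by simp
  assume nz: "\<eta> 0 \<noteq> 0"
  have "\<eta> n = 0" if "n \<in> {..<w} - {0}" for n
  proof (rule ccontr)
    assume "\<eta> n \<noteq> 0"
    then have "{0, n} \<subseteq> {n \<in> {0..<0 + w}. \<eta> n \<noteq> 0}" using nz that by auto
    from card_mono[OF _ this] have "card {0, n} \<le> card {n \<in> {0..<0 + w}. \<eta> n \<noteq> 0}" by simp
    also have "\<dots> \<le> 1" using assms(1) unfolding naf_expansion_def by blast
    finally show False using that by simp
  qed
  then have "(\<Sum>n<w. \<eta> n * b ^ n) = (\<Sum>n\<in>{0}. \<eta> n * b ^ n)"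
    using assms(2) by (intro sum.mono_neutral_right) auto
  then show "b ^ w dvd z - \<eta> 0"
    using digits_value_split[OF fin, of b w] z by simp
qed

lemma naf_digit_0_unique:
  assumes "naf_expansion b (naf_digits b w) w z \<eta>" "naf_expansion b (naf_digits b w) w z \<theta>"
    and w: "w \<ge> 2"
  shows "\<eta> 0 = \<theta> 0"
proof -
  have dig: "\<eta> 0 \<in> naf_digits b w" "\<theta> 0 \<in> naf_digits b w"
    using assms by (auto simp: naf_expansion_def expansion_def)
  note e = naf_digit_0[OF assms(1) w] and t = naf_digit_0[OF assms(2) w]
  have zero: "b dvd x \<longleftrightarrow> x = 0" if "x \<in> naf_digits b w" for x
    using that by (auto simp: naf_digits_def)
  have "b dvd \<eta> 0 \<longleftrightarrow> b dvd \<theta> 0"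
    using dvd_diff[OF t(1) e(1)] dvd_add_right_iff[of b "\<eta> 0 - \<theta> 0" "\<theta> 0"] by simp
  then have iff: "\<eta> 0 = 0 \<longleftrightarrow> \<theta> 0 = 0"
    using zero dig by blast
  show ?thesis
  proof (cases "\<eta> 0 = 0")
    case False
    then have "b ^ w dvd (z - \<theta> 0) - (z - \<eta> 0)"
      using dvd_diff[OF t(2) e(2)] iff by blast
    then have dv: "b ^ w dvd \<eta> 0 - \<theta> 0" by simp
    show ?thesis
    proof (rule ccontr)
      assume "\<eta> 0 \<noteq> \<theta> 0"
      then have "\<bar>b ^ w\<bar> \<le> \<bar>\<eta> 0 - \<theta> 0\<bar>"
        using dv dvd_imp_le_int by force
      moreover have "2 * \<bar>\<eta> 0\<bar> < \<bar>b\<bar> ^ w" "2 * \<bar>\<theta> 0\<bar> < \<bar>b\<bar> ^ w"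
        using dig False iff by (auto simp: naf_digits_def)
      ultimately show False by (simp add: power_abs)
    qed
  qed (use iff in simp)
qed

lemma naf_expansion_unique:
  assumes "naf_expansion b (naf_digits b w) w z \<eta>" "naf_expansion b (naf_digits b w) w z \<theta>"
    and b: "\<bar>b\<bar> \<ge> 2" and w: "w \<ge> 2"
  shows "\<eta> = \<theta>"
proof
  fix n
  show "\<eta> n = \<theta> n"
    using assms(1,2)
  proof (induction n arbitrary: z \<eta> \<theta>)
    case 0
    then show ?case using naf_digit_0_unique w by blast
  next
    case (Suc n)
    have "finite {n. \<eta> n \<noteq> 0}" "finite {n. \<theta> n \<noteq> 0}"
      "digits_value b \<eta> = z" "digits_value b \<theta> = z"
      using Suc.prems by (auto simp: naf_expansion_def expansion_def)
    then have "b * digits_value b (\<lambda>n. \<eta> (n + 1)) = b * digits_value b (\<lambda>n. \<theta> (n + 1))"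
      using digits_value_split[of \<eta> b 1] digits_value_split[of \<theta> b 1]
        naf_digit_0_unique[OF Suc.prems w] by auto
    then have "digits_value b (\<lambda>n. \<eta> (n + 1)) = digits_value b (\<lambda>n. \<theta> (n + 1))"
      using b by auto
    then have "naf_expansion b (naf_digits b w) w (digits_value b (\<lambda>n. \<eta> (n + 1))) (\<lambda>n. \<theta> (n + 1))"
      using naf_expansion_shift[OF Suc.prems(2), of 1] by metis
    from Suc.IH[OF naf_expansion_shift[OF Suc.prems(1), of 1] this] show ?case by simp
  qed
qed

lemma naf_expansion_prepend:
  assumes "naf_expansion b D w z \<theta>" "d \<in> D" "0 \<in> D" "k > 0" "d \<noteq> 0 \<Longrightarrow> k \<ge> w"
  shows "naf_expansion b D w (d + b ^ k * z) (\<lambda>n. if n = 0 then d else if n < k then 0 else \<theta> (n - k))"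
    (is "naf_expansion b D w _ ?\<eta>")
proof -
  have \<theta>: "finite {n. \<theta> n \<noteq> 0}" "\<And>n. \<theta> n \<in> D" "digits_value b \<theta> = z"
    "\<And>j. card {n \<in> {j..<j + w}. \<theta> n \<noteq> 0} \<le> 1"
    using assms(1) by (auto simp: naf_expansion_def expansion_def)
  have "{n. ?\<eta> n \<noteq> 0} \<subseteq> insert 0 ((\<lambda>n. n + k) ` {n. \<theta> n \<noteq> 0})"
  proof
    fix n assume "n \<in> {n. ?\<eta> n \<noteq> 0}"
    then have "n = 0 \<or> n = (n - k) + k \<and> n - k \<in> {n. \<theta> n \<noteq> 0}"
      by (auto split: if_splits)
    then show "n \<in> insert 0 ((\<lambda>n. n + k) ` {n. \<theta> n \<noteq> 0})" by blast
  qed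
  then have fin: "finite {n. ?\<eta> n \<noteq> 0}"
    by (rule finite_subset) (use \<theta> in simp)
  have "(\<Sum>n<k. ?\<eta> n * b ^ n) = (\<Sum>n\<in>{0}. ?\<eta> n * b ^ n)"
    using assms(4) by (intro sum.mono_neutral_right) auto
  then have val: "digits_value b ?\<eta> = d + b ^ k * z"
    using digits_value_split[OF fin, of b k] \<theta>(3) assms(4) by simp
  have "card {n \<in> {j..<j + w}. ?\<eta> n \<noteq> 0} \<le> 1" for j
  proof (cases "j = 0 \<and> d \<noteq> 0")
    case True
    then have "{n \<in> {j..<j + w}. ?\<eta> n \<noteq> 0} \<subseteq> {0}" using assms(5) by auto
    from card_mono[OF _ this] show ?thesis by simp
  next
    case False
    let ?S = "{n \<in> {j..<j + w}. ?\<eta> n \<noteq> 0}"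
    have "?S \<subseteq> (\<lambda>n. n + k) ` {n \<in> {j - k..<j - k + w}. \<theta> n \<noteq> 0}"
    proof
      fix n assume "n \<in> ?S"
      then have "n = (n - k) + k" "n - k \<in> {n \<in> {j - k..<j - k + w}. \<theta> n \<noteq> 0}"
        using False by (auto split: if_splits)
      then show "n \<in> (\<lambda>n. n + k) ` {n \<in> {j - k..<j - k + w}. \<theta> n \<noteq> 0}" by blast
    qed
    then have "card ?S \<le> card {n \<in> {j - k..<j - k + w}. \<theta> n \<noteq> 0}"
      by (intro surj_card_le) auto
    then show ?thesis using \<theta>(4)[of "j - k"] by linarith
  qed
  then show ?thesis
    using fin val \<theta>(2) assms(2,3) by (auto simp: naf_expansion_def expansion_def)
qed

lemma naf_digit_exists:
  assumes ndv: "\<not> b dvd z" and b: "b \<noteq> 0" and w: "w \<ge> 2"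
  shows "\<exists>d \<in> naf_digits b w. d \<noteq> 0 \<and> b ^ w dvd z - d"
proof -
  define m where "m = \<bar>b\<bar> ^ w"
  have ndvd: "\<not> b dvd d" if "b ^ w dvd z - d" for d
  proof
    assume "b dvd d"
    moreover have "b dvd z - d" using dvd_trans[OF dvd_power that] w by simp
    ultimately have "b dvd (z - d) + d" by (intro dvd_add)
    then show False using ndv by simp
  qed
  have pd: "b ^ w dvd x" if "m dvd x" for x
    using that by (simp add: m_def flip: power_abs)
  have half: "2 * \<bar>d\<bar> \<noteq> m" if "\<not> b dvd d" for d
  proof
    assume eq: "2 * \<bar>d\<bar> = m"
    obtain v where v: "w = Suc (Suc v)" using w by (metis add_2_eq_Suc le_Suc_ex)
    have "even \<bar>b\<bar>" using eq by (metis dvd_triv_left even_power m_def)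
    then obtain c where c: "\<bar>b\<bar> = 2 * c" by blast
    have "\<bar>d\<bar> = \<bar>b\<bar> * (\<bar>b\<bar> ^ v * c)" using eq c by (simp add: m_def v)
    then show False using that by (metis abs_dvd_iff dvd_abs_iff dvd_triv_left)
  qed
  have m: "m > 0" using b by (simp add: m_def)
  define r where "r = z mod m"
  have r: "0 \<le> r" "r < m" "m dvd z - r" "m dvd z - (r - m)"
    using m dvd_add[OF dvd_minus_mod[of m z] dvd_refl[of m]] by (auto simp: r_def algebra_simps)
  define d where "d = (if 2 * r < m then r else r - m)"
  have "m dvd z - d" "2 * \<bar>d\<bar> \<le> m" using r by (auto simp: d_def)
  then have "b ^ w dvd z - d" "2 * \<bar>d\<bar> < m" "\<not> b dvd d"
    using pd ndvd half by (auto simp: order.strict_iff_order)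
  then show ?thesis by (intro bexI[of _ d]) (auto simp: naf_digits_def m_def)
qed

lemma quotient_bound:
  fixes x y d m :: int
  assumes "4 \<le> m" "2 * d < m" "m * y \<le> x + d" "1 \<le> x"
  shows "y < x"
proof (rule ccontr)
  assume "\<not> y < x"
  then have "m * x \<le> m * y" using assms(1) by (intro mult_left_mono) auto
  moreover have "4 * (x - 1) \<le> m * (x - 1)" using assms by (intro mult_right_mono) auto
  then have "4 * x - 4 + m \<le> m * x" by (simp add: algebra_simps)
  ultimately show False using assms by linarith
qed

lemma naf_expansion_exists:
  assumes b: "\<bar>b\<bar> \<ge> 2" and w: "w \<ge> 2"
  shows "\<exists>\<eta>. naf_expansion b (naf_digits b w) w z \<eta>"
proof (induction "nat \<bar>z\<bar>" arbitrary: z rule: less_induct)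
  case less
  show ?case
  proof (cases "z = 0")
    case True
    then have "naf_expansion b (naf_digits b w) w z (\<lambda>_. 0)"
      by (simp add: naf_expansion_def expansion_def digits_value_def naf_digits_def)
    then show ?thesis by blast
  next
    case z: False
    show ?thesis
    proof (cases "b dvd z")
      case True
      then obtain y where y: "z = b * y" by blast
      have "\<bar>z\<bar> \<ge> 2 * \<bar>y\<bar>" using b by (simp add: y abs_mult mult_right_mono)
      then have "nat \<bar>y\<bar> < nat \<bar>z\<bar>" using z y by auto
      from less[OF this] obtain \<theta> where "naf_expansion b (naf_digits b w) w y \<theta>" by blast
      from naf_expansion_prepend[OF this, of 0 1] show ?thesis
        by (auto simp: y naf_digits_def)
    next
      case False
      obtain d where d: "d \<in> naf_digits b w" "d \<noteq> 0" "b ^ w dvd z - d"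
        using naf_digit_exists[OF False _ w] b by fastforce
      then obtain y where "z - d = b ^ w * y" by blast
      then have y: "z = d + b ^ w * y" by simp
      have "(4::int) = 2 ^ 2" by simp
      also have "\<dots> \<le> 2 ^ w" using w by (intro power_increasing) auto
      also have "\<dots> \<le> \<bar>b\<bar> ^ w" using b by (intro power_mono) auto
      finally have 4: "4 \<le> \<bar>b\<bar> ^ w" .
      have "2 * \<bar>d\<bar> < \<bar>b\<bar> ^ w" using d by (auto simp: naf_digits_def)
      moreover have "\<bar>b\<bar> ^ w * \<bar>y\<bar> \<le> \<bar>z\<bar> + \<bar>d\<bar>"
        using abs_triangle_ineq4[of z d] by (simp add: \<open>z - d = b ^ w * y\<close> abs_mult power_abs)
      moreover have "\<bar>z\<bar> \<ge> 1" using z by simp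
      ultimately have "\<bar>y\<bar> < \<bar>z\<bar>" using quotient_bound 4 by blast
      then have "nat \<bar>y\<bar> < nat \<bar>z\<bar>" by auto
      from less[OF this] obtain \<theta> where "naf_expansion b (naf_digits b w) w y \<theta>" by blast
      from naf_expansion_prepend[OF this d(1), of w] show ?thesis
        using w by (auto simp: y naf_digits_def)
    qed
  qed
qed

theorem naf_expansion_ex1:
  assumes "\<bar>b\<bar> \<ge> 2" and "w \<ge> 2"
  shows "\<exists>!\<eta>. naf_expansion b (naf_digits b w) w z \<eta>"
  using naf_expansion_exists[OF assms] naf_expansion_unique[OF _ _ assms] by blast

end

theory Submission
  imports Defs
begin

text \<open>
  The weight of the \<open>w\<close>-NAF turns out to be subadditive: adding a single term \<open>d * b ^ n\<close>, with a
  digit \<open>d\<close>, to an integer raises the weight of its \<open>w\<close>-NAF by at most one. Adding up the terms of a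
  multi-expansion of \<open>z\<close> one by one, starting from \<open>0\<close>, then produces a \<open>w\<close>-NAF of \<open>z\<close> that is not
  heavier than the multi-expansion, and since \<open>z\<close> has only one \<open>w\<close>-NAF, that one is optimal.

  Subadditivity goes by induction on the weight. If the new term is at distance at least \<open>w\<close> from the
  lowest term of the \<open>w\<close>-NAF, then either it becomes the lowest term itself, or it is added to the
  remaining terms, which have smaller weight. Otherwise, up to a power of \<open>b\<close>, two digits \<open>c\<close> and \<open>d\<close>
  (both non-zero) meet in a sum \<open>c + d * b ^ i\<close> with \<open>i < w\<close>. Two properties of the digit set, both due to its being
  cut out by an interval around \<open>0\<close>, show that such a sum can be replaced by at most two terms of
  which all but one can be pushed into the part of smaller weight:

  \<^item> an integer \<open>s\<close> with \<open>2 * \<bar>s\<bar> < \<bar>b\<bar> ^ w\<close> is \<open>0\<close> or a digit times a power of \<open>b\<close>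
    (\<open>small_int_cases\<close>), so that small integers are as good as digits;
  \<^item> a sum \<open>c + d * b ^ i\<close> that is not divisible by \<open>b\<close> is \<open>e + b ^ w * s\<close> with a digit \<open>e\<close> and
    a small carry \<open>s\<close> (\<open>digit_sum_carry\<close>); if it is divisible by \<open>b\<close>, then \<open>i = 0\<close> and
    \<open>c + d\<close> is \<open>b\<close> times a small integer.
\<close>

section \<open>Integers with a non-adjacent form of bounded weight\<close>

text \<open>
  The recursion peels off the lowest non-zero digit \<open>d\<close>, at position \<open>j\<close>. The power \<open>b ^ j\<close> is kept
  in the same step as the digit so that the weight bound alone controls the recursion.
\<close>

primrec naf_weight_le :: "int \<Rightarrow> nat \<Rightarrow> nat \<Rightarrow> int \<Rightarrow> bool" where
  "naf_weight_le b w 0 z \<longleftrightarrow> z = 0"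
| "naf_weight_le b w (Suc k) z \<longleftrightarrow> z = 0 \<or>
     (\<exists>j. \<exists>d \<in> naf_digits b w - {0}. \<exists>y. z = b ^ j * (d + b ^ w * y) \<and> naf_weight_le b w k y)"

lemma naf_weight_le_zero [simp]: "naf_weight_le b w k 0"
  by (cases k) auto

lemma naf_weight_le_digit:
  assumes "naf_weight_le b w k y" "d \<in> naf_digits b w" "d \<noteq> 0"
  shows "naf_weight_le b w (Suc k) (d + b ^ w * y)"
proof -
  have "d + b ^ w * y = b ^ 0 * (d + b ^ w * y)" by simp
  then show ?thesis using assms unfolding naf_weight_le.simps by blast
qed

lemma naf_weight_le_shift:
  assumes "naf_weight_le b w k z"
  shows "naf_weight_le b w k (b ^ i * z)"
proof (cases k)
  case (Suc l)
  have "b ^ i * (b ^ j * x) = b ^ (i + j) * x" for j x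
    by (simp add: power_add)
  then show ?thesis using assms unfolding Suc naf_weight_le.simps
    by (metis mult_zero_right)
qed (use assms in simp)

lemma naf_weight_le_Suc: "naf_weight_le b w k z \<Longrightarrow> naf_weight_le b w (Suc k) z"
proof (induction k arbitrary: z)
  case (Suc k)
  then show ?case unfolding naf_weight_le.simps(2)[of b w "Suc k"]
    unfolding naf_weight_le.simps(2)[of b w k] by (metis naf_weight_le.simps(2))
qed simp

text \<open>The predicate yields honest expansions: each step of its recursion prepends digits to a NAF.\<close>

lemma naf_weight_le_imp_naf_expansion:
  assumes w: "w \<ge> 2" and "naf_weight_le b w k z"
  shows "\<exists>\<eta>. naf_expansion b (naf_digits b w) w z \<eta> \<and> card {n. \<eta> n \<noteq> 0} \<le> k"
  using assms(2)
proof (induction k arbitrary: z)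
  case zero: 0
  then show ?case
    by (intro exI[of _ "\<lambda>_. 0"])
      (simp add: naf_expansion_def expansion_def digits_value_def naf_digits_def)
next
  case (Suc k)
  show ?case
  proof (cases "z = 0")
    case True
    then show ?thesis
      by (intro exI[of _ "\<lambda>_. 0"])
        (simp add: naf_expansion_def expansion_def digits_value_def naf_digits_def)
  next
    case False
    then obtain j d y where d: "d \<in> naf_digits b w" and z: "z = b ^ j * (d + b ^ w * y)"
      and "naf_weight_le b w k y"
      using Suc.prems by auto
    with Suc.IH obtain \<theta> where \<theta>: "naf_expansion b (naf_digits b w) w y \<theta>"
      and card: "card {n. \<theta> n \<noteq> 0} \<le> k" by blast
    have fin: "finite {n. \<theta> n \<noteq> 0}"
      using \<theta> by (simp add: naf_expansion_def expansion_def)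
    have D0: "0 \<in> naf_digits b w" by (simp add: naf_digits_def)
    define \<mu> where "\<mu> n = (if n = 0 then d else if n < w then 0 else \<theta> (n - w))" for n
    have \<mu>: "naf_expansion b (naf_digits b w) w (d + b ^ w * y) \<mu>"
      unfolding \<mu>_def using naf_expansion_prepend[OF \<theta> d D0, of w] w by simp
    define \<eta> where "\<eta> n = (if n < j then 0 else \<mu> (n - j))" for n
    have \<eta>: "naf_expansion b (naf_digits b w) w z \<eta>"
    proof (cases "j = 0")
      case True
      then have "\<eta> = \<mu>" by (simp add: \<eta>_def fun_eq_iff)
      then show ?thesis using \<mu> True by (simp add: z)
    next
      case False
      then have "\<eta> = (\<lambda>n. if n = 0 then 0 else if n < j then 0 else \<mu> (n - j))"
        by (auto simp: \<eta>_def)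
      then show ?thesis using naf_expansion_prepend[OF \<mu> D0 D0, of j] False by (simp add: z)
    qed
    have "{n. \<eta> n \<noteq> 0} \<subseteq> insert j ((\<lambda>n. n + (w + j)) ` {n. \<theta> n \<noteq> 0})"
    proof
      fix n assume "n \<in> {n. \<eta> n \<noteq> 0}"
      then have "n = j \<or> n = (n - j - w) + (w + j) \<and> n - j - w \<in> {n. \<theta> n \<noteq> 0}"
        by (auto simp: \<eta>_def \<mu>_def split: if_splits)
      then show "n \<in> insert j ((\<lambda>n. n + (w + j)) ` {n. \<theta> n \<noteq> 0})" by blast
    qed
    then have "card {n. \<eta> n \<noteq> 0} \<le> card (insert j ((\<lambda>n. n + (w + j)) ` {n. \<theta> n \<noteq> 0}))"
      using fin by (intro card_mono) auto
    also have "\<dots> \<le> Suc (card {n. \<theta> n \<noteq> 0})"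
      using card_image_le[OF fin, of "\<lambda>n. n + (w + j)"] fin by (simp add: card_insert_if)
    finally show ?thesis using \<eta> card by (intro exI[of _ \<eta>]) simp
  qed
qed

section \<open>Small integers and sums of two digits\<close>

lemma small_int_cases:
  assumes b: "\<bar>b\<bar> \<ge> 2" and s: "2 * \<bar>s\<bar> < \<bar>b\<bar> ^ w"
  shows "s = 0 \<or> (\<exists>j. \<exists>d \<in> naf_digits b w - {0}. s = d * b ^ j)"
  using s
proof (induction "nat \<bar>s\<bar>" arbitrary: s rule: less_induct)
  case less
  show ?case
  proof (cases "b dvd s \<and> s \<noteq> 0")
    case True
    then obtain t where t: "s = b * t" by blast
    have "\<bar>s\<bar> \<ge> 2 * \<bar>t\<bar>" using b by (simp add: t abs_mult mult_right_mono)
    then have "nat \<bar>t\<bar> < nat \<bar>s\<bar>" "2 * \<bar>t\<bar> < \<bar>b\<bar> ^ w" using True t less.prems by auto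
    from less.hyps[OF this] True t obtain j d where "d \<in> naf_digits b w - {0}" "t = d * b ^ j"
      by auto
    moreover from this have "s = d * b ^ Suc j" by (simp add: t)
    ultimately show ?thesis by blast
  next
    case False
    then have "s = 0 \<or> s \<in> naf_digits b w - {0} \<and> s = s * b ^ 0"
      using less.prems by (auto simp: naf_digits_def)
    then show ?thesis by blast
  qed
qed

text \<open>
  The digit \<open>e\<close> is the one congruent to the sum modulo \<open>b ^ w\<close>. The carry stays small because
  \<open>c\<close> and \<open>e\<close> together contribute less than \<open>1\<close> to \<open>\<bar>s\<bar>\<close>, and \<open>d * b ^ i\<close> less than half of
  \<open>\<bar>b\<bar> ^ i \<le> \<bar>b\<bar> ^ w / 2\<close>, which leaves room for the \<open>1\<close> when \<open>w \<ge> 2\<close>.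
\<close>

lemma digit_sum_carry:
  assumes b: "\<bar>b\<bar> \<ge> 2" and w: "w \<ge> 2" and i: "i < w"
    and c: "2 * \<bar>c\<bar> < \<bar>b\<bar> ^ w" and d: "2 * \<bar>d\<bar> < \<bar>b\<bar> ^ w"
    and ndv: "\<not> b dvd c + d * b ^ i"
  shows "\<exists>e \<in> naf_digits b w - {0}. \<exists>s. 2 * \<bar>s\<bar> < \<bar>b\<bar> ^ w \<and> c + d * b ^ i = e + b ^ w * s"
proof -
  obtain e where e: "e \<in> naf_digits b w" "e \<noteq> 0" "b ^ w dvd c + d * b ^ i - e"
    using naf_digit_exists[OF ndv _ w] b by fastforce
  then obtain s where s: "c + d * b ^ i - e = b ^ w * s" by blast
  define m where "m = \<bar>b\<bar> ^ w"
  define p where "p = \<bar>b\<bar> ^ i"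
  have pos: "m > 0" "p > 0" using b by (auto simp: m_def p_def)
  have "2 * \<bar>e\<bar> < m" using e by (auto simp: naf_digits_def m_def)
  have "m * \<bar>s\<bar> = \<bar>c + d * b ^ i - e\<bar>"
    by (simp add: s abs_mult power_abs m_def)
  also have "\<dots> \<le> \<bar>c\<bar> + \<bar>d\<bar> * p + \<bar>e\<bar>"
    using abs_triangle_ineq4[of "c + d * b ^ i" e] abs_triangle_ineq[of c "d * b ^ i"]
    by (simp add: abs_mult power_abs p_def)
  finally have "m * (2 * \<bar>s\<bar>) \<le> 2 * \<bar>c\<bar> + 2 * \<bar>d\<bar> * p + 2 * \<bar>e\<bar>" by simp
  moreover have "2 * \<bar>d\<bar> * p < m * p"
    using d pos by (intro mult_strict_right_mono) (auto simp: m_def)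
  ultimately have "m * (2 * \<bar>s\<bar>) < m * (2 + p)"
    using c \<open>2 * \<bar>e\<bar> < m\<close> by (simp add: m_def algebra_simps)
  then have s2: "2 * \<bar>s\<bar> < 2 + p" using pos by simp
  obtain v where v: "w = Suc v" "v \<ge> 1" using w by (cases w) auto
  have "p \<le> \<bar>b\<bar> ^ v" using i v b by (auto simp: p_def intro: power_increasing)
  moreover have "\<bar>b\<bar> ^ 1 \<le> \<bar>b\<bar> ^ v" using v b by (intro power_increasing) auto
  moreover have "2 * \<bar>b\<bar> ^ v \<le> m" using b by (simp add: m_def v mult_right_mono)
  ultimately have "2 + p \<le> m" using b by simp
  then have "2 * \<bar>s\<bar> < \<bar>b\<bar> ^ w" using s2 by (simp add: m_def)
  moreover have "c + d * b ^ i = e + b ^ w * s" using s by simp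
  ultimately show ?thesis using e by blast
qed

section \<open>Subadditivity of the weight\<close>

text \<open>
  Two colliding digits on top of a remainder of weight at most \<open>k\<close>. The hypothesis \<open>IH\<close> is the
  induction hypothesis of the subadditivity lemma below; it absorbs the small carry into the remainder.
\<close>

lemma naf_weight_le_two_digits:
  assumes b: "\<bar>b\<bar> \<ge> 2" and w: "w \<ge> 2" and i: "i < w"
    and c: "c \<in> naf_digits b w" "c \<noteq> 0" and d: "d \<in> naf_digits b w"
    and IH: "\<And>y s n. naf_weight_le b w k y \<Longrightarrow> 2 * \<bar>s\<bar> < \<bar>b\<bar> ^ w \<Longrightarrow>
      naf_weight_le b w (Suc k) (y + s * b ^ n)"
    and y: "naf_weight_le b w k y"
  shows "naf_weight_le b w (Suc (Suc k)) (c + d * b ^ i + b ^ w * y)"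
proof -
  have cd: "2 * \<bar>c\<bar> < \<bar>b\<bar> ^ w" "2 * \<bar>d\<bar> < \<bar>b\<bar> ^ w" "\<not> b dvd c"
    using c d b by (auto simp: naf_digits_def)
  show ?thesis
  proof (cases "b dvd c + d * b ^ i")
    case False
    obtain e s where e: "e \<in> naf_digits b w - {0}" and s: "2 * \<bar>s\<bar> < \<bar>b\<bar> ^ w"
      and eq: "c + d * b ^ i = e + b ^ w * s"
      using digit_sum_carry[OF b w i cd(1,2) False] by blast
    have "naf_weight_le b w (Suc (Suc k)) (e + b ^ w * (y + s * b ^ 0))"
      using naf_weight_le_digit IH[OF y s] e by blast
    then show ?thesis unfolding eq by (simp add: algebra_simps)
  next
    case True
    have "i = 0"
    proof (rule ccontr)
      assume "i \<noteq> 0"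
      then have "b dvd d * b ^ i" by (simp add: dvd_power)
      then show False using True cd(3) by (simp add: dvd_add_left_iff)
    qed
    then obtain u where u: "c + d = b * u" using True by auto
    \<comment> \<open>Here \<open>\<bar>c + d\<bar> < \<bar>b\<bar> ^ w\<close>, and the division by \<open>b\<close> halves this bound.\<close>
    have "2 * \<bar>u\<bar> \<le> \<bar>b * u\<bar>" using b by (simp add: abs_mult mult_right_mono)
    also have "\<dots> < \<bar>b\<bar> ^ w" using u cd(1,2) by linarith
    finally have "naf_weight_le b w (Suc k) (b ^ (w - 1) * y + u * b ^ 0)"
      using IH naf_weight_le_shift[OF y] by blast
    then have "naf_weight_le b w (Suc (Suc k)) (b ^ 1 * (b ^ (w - 1) * y + u * b ^ 0))"
      using naf_weight_le_shift naf_weight_le_Suc by blast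
    moreover have "b * b ^ (w - 1) = b ^ w" using w by (cases w) auto
    then have "b ^ 1 * (b ^ (w - 1) * y + u * b ^ 0) = c + d * b ^ i + b ^ w * y"
      using u \<open>i = 0\<close> by (simp add: distrib_left flip: mult.assoc)
    ultimately show ?thesis by (simp only:)
  qed
qed

text \<open>
  Stated for small integers instead of digits, so that the induction hypothesis applies to carries.
\<close>

lemma naf_weight_le_add:
  assumes b: "\<bar>b\<bar> \<ge> 2" and w: "w \<ge> 2"
    and "naf_weight_le b w k z" and "2 * \<bar>s\<bar> < \<bar>b\<bar> ^ w"
  shows "naf_weight_le b w (Suc k) (z + s * b ^ n)"
  using assms(3,4)
proof (induction k arbitrary: z s n)
  case zero: 0
  consider "s = 0" | d j where "d \<in> naf_digits b w - {0}" "s = d * b ^ j"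
    using small_int_cases[OF b zero.prems(2)] by blast
  then show ?case
  proof cases
    case 1
    then show ?thesis using zero.prems by simp
  next
    case 2
    then have "naf_weight_le b w (Suc 0) (b ^ (j + n) * (d + b ^ w * 0))"
      by (intro naf_weight_le_shift naf_weight_le_digit) auto
    then show ?thesis using zero.prems(1) 2 by (simp add: power_add mult_ac)
  qed
next
  case (Suc k)
  have add_digit: "naf_weight_le b w (Suc (Suc k)) (z + d * b ^ n)"
    if d: "d \<in> naf_digits b w" "d \<noteq> 0" for d n
  proof (cases "z = 0")
    case True
    have "naf_weight_le b w (Suc (Suc k)) (b ^ n * (d + b ^ w * 0))"
      using d by (intro naf_weight_le_shift naf_weight_le_digit) auto
    then show ?thesis using True by (simp add: mult.commute)
  next
    case False
    then obtain j c y where c: "c \<in> naf_digits b w" "c \<noteq> 0"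
      and z: "z = b ^ j * (c + b ^ w * y)" and y: "naf_weight_le b w k y"
      using Suc.prems(1) by auto
    have small_d: "2 * \<bar>d\<bar> < \<bar>b\<bar> ^ w" using d by (auto simp: naf_digits_def)
    \<comment> \<open>The position \<open>n\<close> of the new digit relative to the position \<open>j\<close> of the lowest digit of \<open>z\<close>.\<close>
    consider "j + w \<le> n" | "j \<le> n" "n < j + w" | "n < j" "j < n + w" | "n + w \<le> j" by linarith
    then show ?thesis
    proof cases
      case 1
      then obtain q where q: "n = j + w + q" using le_Suc_ex by blast
      have "naf_weight_le b w (Suc (Suc k)) (b ^ j * (c + b ^ w * (y + d * b ^ q)))"
        by (intro naf_weight_le_shift naf_weight_le_digit Suc.IH y small_d c)
      then show ?thesis by (simp add: z q power_add algebra_simps)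
    next
      case 2
      then obtain q where q: "n = j + q" "q < w" using le_Suc_ex by fastforce
      have "naf_weight_le b w (Suc (Suc k)) (b ^ j * (c + d * b ^ q + b ^ w * y))"
        by (intro naf_weight_le_shift naf_weight_le_two_digits[OF b w q(2) c d(1) Suc.IH y])
      then show ?thesis by (simp add: z q power_add algebra_simps)
    next
      case 3
      then obtain q where q: "j = n + q" "q < w"
        using le_Suc_ex[of n j] by fastforce
      have "naf_weight_le b w (Suc (Suc k)) (b ^ n * (d + c * b ^ q + b ^ w * (b ^ q * y)))"
        by (intro naf_weight_le_shift
            naf_weight_le_two_digits[OF b w q(2) d c(1) Suc.IH naf_weight_le_shift[OF y]])
      then show ?thesis by (simp add: z q power_add algebra_simps)
    next
      case 4
      then obtain q where q: "j = n + w + q" using le_Suc_ex by blast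
      have "naf_weight_le b w (Suc (Suc k)) (b ^ n * (d + b ^ w * (b ^ q * (c + b ^ w * y))))"
        by (intro naf_weight_le_shift naf_weight_le_digit y c d)
      then show ?thesis by (simp add: z q power_add algebra_simps)
    qed
  qed
  consider "s = 0" | d j where "d \<in> naf_digits b w - {0}" "s = d * b ^ j"
    using small_int_cases[OF b Suc.prems(2)] by blast
  then show ?case
  proof cases
    case 1
    then show ?thesis using naf_weight_le_Suc[OF Suc.prems(1)] by simp
  next
    case 2
    then show ?thesis using add_digit[of d "j + n"] by (simp add: power_add mult.assoc)
  qed
qed

section \<open>Optimality\<close>

lemma multi_expansion_imp_naf_weight_le:
  assumes b: "\<bar>b\<bar> \<ge> 2" and w: "w \<ge> 2"
    and "multi_expansion b (naf_digits b w) z M"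
  shows "naf_weight_le b w (size M) z"
  using assms(3)
proof (induction M arbitrary: z)
  case empty
  then show ?case by (simp add: multi_expansion_def)
next
  case (add p M)
  obtain d n where p: "p = (d, n)" by force
  have "multi_expansion b (naf_digits b w) (z - d * b ^ n) M"
    and d: "d \<in> naf_digits b w" "d \<noteq> 0"
    using add.prems by (auto simp: multi_expansion_def p)
  from add.IH[OF this(1)] have "naf_weight_le b w (Suc (size M)) (z - d * b ^ n + d * b ^ n)"
    using d by (intro naf_weight_le_add[OF b w]) (auto simp: naf_digits_def)
  then show ?case by simp
qed

theorem theorem4p1:
  fixes b z :: int and w :: nat and \<eta> :: "nat \<Rightarrow> int"
  assumes "\<bar>b\<bar> \<ge> 2" and "w \<ge> 2"
    and "naf_expansion b (naf_digits b w) w z \<eta>"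
  shows "optimal_expansion b (naf_digits b w) z \<eta>"
  unfolding optimal_expansion_def
proof (intro conjI allI impI)
  show "expansion b (naf_digits b w) z \<eta>"
    using assms(3) by (simp add: naf_expansion_def)
next
  fix M assume "multi_expansion b (naf_digits b w) z M"
  from multi_expansion_imp_naf_weight_le[OF assms(1,2) this]
  obtain \<theta> where "naf_expansion b (naf_digits b w) w z \<theta>" and le: "card {n. \<theta> n \<noteq> 0} \<le> size M"
    using naf_weight_le_imp_naf_expansion[OF assms(2)] by blast
  then have "\<eta> = \<theta>"
    using naf_expansion_unique[OF assms(3) _ assms(1,2)] by blast
  then show "size (digits_mset \<eta>) \<le> size M"
    using le by (simp add: digits_mset_def)
qed

end
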